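(* Let $\mathcal B$ be a partition of $\mathcal J=\{1,\dots,J\}$, with bounds $0\le\underline v_b\le\overline v_b<\infty$, $\overline v_b>0$ for $b\in\mathcal B$, and $\max_{b\in\mathcal B}\underline v_b>0$, and let $$\mathcal V_{\mathcal B}=\Big\{\boldsymbol v\in\mathbb R_+^J:\ \sum_{j\in b}v_j\in[\underline v_b,\overline v_b]\ \ \forall b\in\mathcal B\Big\}.$$ Let $\gamma^*_{\mathcal B}\in(0,1]$ be the unique solution of $$\phi(\gamma)=\gamma e^{-1/\gamma}\sum_{b\in\mathcal S(\gamma)}\overline v_b-\sum_{b\in\mathcal B\setminus\mathcal S(\gamma)}\underline v_b\big(\gamma\ln(\underline v_b/\overline v_b)-\gamma+1\big)=0,\qquad \mathcal S(\gamma)=\{b\in\mathcal B:\ \ln(\underline v_b/\overline v_b)<-1/\gamma\}.$$ Then the mechanism $M^{\mathcal B}_{\gamma^*_{\mathcal B}}$ is optimal for $$\sup_{M\in\mathcal M}\ \inf_{\mathbb F\in\Delta(\mathcal V_{\mathcal B})}\frac{\mathrm{Rev}(M,\mathbb F)}{\sup_{M'\in\mathcal M}\mathrm{Rev}(M',\mathbb F)},$$ and it achieves an approximation ratio (value of the inner infimum) of $\gamma^*_{\mathcal B}$.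
   Context: $\Delta(\mathcal V_{\mathcal B})$ is the set of Borel probability distributions on $\mathcal V_{\mathcal B}$. A mechanism $M=(\boldsymbol q,t)$ on $\mathcal V_{\mathcal B}$ consists of $\boldsymbol q:\mathcal V_{\mathcal B}\to[0,1]^J$ and a (Borel measurable) $t:\mathcal V_{\mathcal B}\to\mathbb R_+$. $\mathcal M$ is the set of mechanisms satisfying, for all $\boldsymbol v,\boldsymbol v'\in\mathcal V_{\mathcal B}$, incentive compatibility $\boldsymbol q(\boldsymbol v)^\top\boldsymbol v-t(\boldsymbol v)\ge\boldsymbol q(\boldsymbol v')^\top\boldsymbol v-t(\boldsymbol v')$ and individual rationality $\boldsymbol q(\boldsymbol v)^\top\boldsymbol v-t(\boldsymbol v)\ge0$. $\mathrm{Rev}(M,\mathbb F)=\int t\,d\mathbb F$. Bundle-wise separable mechanism $M^{\mathcal B}_\gamma$ ($\gamma\in(0,1]$): for $j\in\mathcal J$ let $b(j)\in\mathcal B$ be the bundle containing $j$. Then $[\boldsymbol q(\boldsymbol v)]_j=\Big(\gamma\ln\frac{\sum_{i\in b(j)}v_i}{\overline v_{b(j)}}+1\Big)^+$ (convention $\ln0=-\infty$, $x^+=\max\{x,0\}$), and $t(\boldsymbol v)=\sum_{b\in\mathcal B}t_b\big(\sum_{j\in b}v_j\big)$, where for $w\in[\underline v_b,\overline v_b]$: $t_b(w)=\gamma\,(w-e^{-1/\gamma}\overline v_b)^+$ if $e^{-1/\gamma}\overline v_b>\underline v_b$, and $t_b(w)=\gamma w+\underline v_b\big(\gamma\ln\frac{\underline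 v_b}{e\,\overline v_b}+1\big)$ if $e^{-1/\gamma}\overline v_b\le\underline v_b$. *)

theory Defs
  imports "HOL-Probability.Probability"
begin

section \<open>Mechanisms on a set of valuations\<close>

text \<open>A mechanism is a pair of an allocation rule and a payment rule. Only the values on the
  valuation set \<^term>\<open>V\<close> matter; values elsewhere are arbitrary and never enter any quantity below.
  As usual, only the payment rule is required to be measurable.\<close>

type_synonym 'n mechanism = "(real ^ 'n \<Rightarrow> real ^ 'n) \<times> (real ^ 'n \<Rightarrow> real)"

definition is_mechanism :: "(real ^ 'n) set \<Rightarrow> 'n::finite mechanism \<Rightarrow> bool" where
  "is_mechanism V = (\<lambda>(q, t).
     (\<forall>v\<in>V. \<forall>j. q v $ j \<in> {0..1}) \<and> (\<forall>v\<in>V. 0 \<le> t v) \<and>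
     t \<in> borel_measurable (restrict_space borel V))"

definition incentive_compatible :: "(real ^ 'n) set \<Rightarrow> 'n::finite mechanism \<Rightarrow> bool" where
  "incentive_compatible V = (\<lambda>(q, t).
     \<forall>v\<in>V. \<forall>v'\<in>V. q v \<bullet> v - t v \<ge> q v' \<bullet> v - t v')"

definition individually_rational :: "(real ^ 'n) set \<Rightarrow> 'n::finite mechanism \<Rightarrow> bool" where
  "individually_rational V = (\<lambda>(q, t). \<forall>v\<in>V. q v \<bullet> v - t v \<ge> 0)"

definition mechanisms :: "(real ^ 'n) set \<Rightarrow> 'n::finite mechanism set" where
  "mechanisms V =
     {M. is_mechanism V M \<and> incentive_compatible V M \<and> individually_rational V M}"

definition distributions :: "(real ^ 'n) set \<Rightarrow> (real ^ 'n::finite) measure set" where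
  "distributions V = {F. prob_space F \<and> sets F = sets (restrict_space borel V)}"

definition revenue :: "'n::finite mechanism \<Rightarrow> (real ^ 'n) measure \<Rightarrow> real" where
  "revenue M F = (\<integral>v. snd M v \<partial>F)"

text \<open>The suprema and infima are taken in \<^typ>\<open>real\<close>. On the valuation sets used here they
  range over nonempty bounded sets, and the optimal revenue is positive; see the last section.\<close>

definition optimal_revenue :: "(real ^ 'n) set \<Rightarrow> (real ^ 'n::finite) measure \<Rightarrow> real" where
  "optimal_revenue V F = (SUP M\<in>mechanisms V. revenue M F)"

definition approx_ratio :: "(real ^ 'n) set \<Rightarrow> 'n::finite mechanism \<Rightarrow> real" where
  "approx_ratio V M = (INF F\<in>distributions V. revenue M F / optimal_revenue V F)"


section \<open>Bundle-wise separable mechanisms\<close>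

definition bundle_valuations ::
    "'n set set \<Rightarrow> ('n set \<Rightarrow> real) \<Rightarrow> ('n set \<Rightarrow> real) \<Rightarrow> (real ^ 'n::finite) set" where
  "bundle_valuations B lo hi =
     {v. (\<forall>j. 0 \<le> v $ j) \<and> (\<forall>b\<in>B. (\<Sum>j\<in>b. v $ j) \<in> {lo b..hi b})}"

text \<open>The logarithm on the nonnegative reals with \<open>ln 0 = -\<infinity>\<close>; note that
  \<^term>\<open>ln (0::real)\<close> is \<^term>\<open>0::real\<close> in HOL.\<close>

definition ext_ln :: "real \<Rightarrow> ereal" where
  "ext_ln x = (if x = 0 then -\<infinity> else ereal (ln x))"

definition bundle_of :: "'n set set \<Rightarrow> 'n \<Rightarrow> 'n set" where
  "bundle_of B j = (THE b. b \<in> B \<and> j \<in> b)"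

definition bundle_alloc ::
    "'n set set \<Rightarrow> ('n set \<Rightarrow> real) \<Rightarrow> real \<Rightarrow> real ^ 'n \<Rightarrow> real ^ 'n::finite" where
  "bundle_alloc B hi \<gamma> v = (\<chi> j.
     real_of_ereal
       (max 0 (ereal \<gamma> * ext_ln ((\<Sum>i\<in>bundle_of B j. v $ i) / hi (bundle_of B j)) + 1)))"

definition bundle_price ::
    "('n set \<Rightarrow> real) \<Rightarrow> ('n set \<Rightarrow> real) \<Rightarrow> real \<Rightarrow> 'n set \<Rightarrow> real \<Rightarrow> real" where
  "bundle_price lo hi \<gamma> b w =
     (if exp (- 1 / \<gamma>) * hi b > lo b
      then \<gamma> * max 0 (w - exp (- 1 / \<gamma>) * hi b)
      else \<gamma> * w + lo b * (\<gamma> * ln (lo b / (exp 1 * hi b)) + 1))"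

definition bundle_mechanism ::
    "'n set set \<Rightarrow> ('n set \<Rightarrow> real) \<Rightarrow> ('n set \<Rightarrow> real) \<Rightarrow> real \<Rightarrow> 'n::finite mechanism" where
  "bundle_mechanism B lo hi \<gamma> =
     (bundle_alloc B hi \<gamma>, \<lambda>v. \<Sum>b\<in>B. bundle_price lo hi \<gamma> b (\<Sum>j\<in>b. v $ j))"

definition low_bundles ::
    "'n set set \<Rightarrow> ('n set \<Rightarrow> real) \<Rightarrow> ('n set \<Rightarrow> real) \<Rightarrow> real \<Rightarrow> 'n set set" where
  "low_bundles B lo hi \<gamma> = {b \<in> B. ext_ln (lo b / hi b) < ereal (- 1 / \<gamma>)}"

text \<open>In the second sum \<open>lo b > 0\<close>, so the real logarithm may be used.\<close>

definition ratio_eqn ::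
    "'n set set \<Rightarrow> ('n set \<Rightarrow> real) \<Rightarrow> ('n set \<Rightarrow> real) \<Rightarrow> real \<Rightarrow> real" where
  "ratio_eqn B lo hi \<gamma> =
     \<gamma> * exp (- 1 / \<gamma>) * (\<Sum>b\<in>low_bundles B lo hi \<gamma>. hi b)
     - (\<Sum>b\<in>B - low_bundles B lo hi \<gamma>. lo b * (\<gamma> * ln (lo b / hi b) - \<gamma> + 1))"

definition gamma_star ::
    "'n set set \<Rightarrow> ('n set \<Rightarrow> real) \<Rightarrow> ('n set \<Rightarrow> real) \<Rightarrow> real" where
  "gamma_star B lo hi = (THE \<gamma>. \<gamma> \<in> {0<..1} \<and> ratio_eqn B lo hi \<gamma> = 0)"


section \<open>Nondegeneracy of the revenue and of the approximation ratio\<close>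

locale bundle_bounds =
  fixes B :: "'n::finite set set" and lo hi :: "'n set \<Rightarrow> real"
  assumes partition: "partition_on UNIV B"
    and bounds: "\<And>b. b \<in> B \<Longrightarrow> 0 \<le> lo b \<and> lo b \<le> hi b \<and> 0 < hi b"
    and some_pos: "Max (lo ` B) > 0"
begin

abbreviation "V \<equiv> bundle_valuations B lo hi"

lemma sum_bundles: "(\<Sum>j\<in>UNIV. f j) = (\<Sum>b\<in>B. \<Sum>j\<in>b. f j)" for f :: "'n \<Rightarrow> real"
proof -
  have "(\<Sum>j\<in>\<Union>B. f j) = (sum \<circ> sum) f B"
    using partition by (intro sum.Union_disjoint) (auto simp: partition_on_def disjoint_def)
  then show ?thesis using partition by (simp add: partition_on_def)
qed

lemma sum_lo_pos: "0 < (\<Sum>b\<in>B. lo b)"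
proof -
  have "B \<noteq> {}" using partition by (auto simp: partition_on_def)
  then have "Max (lo ` B) \<in> lo ` B" by (intro Max_in) auto
  then obtain b where "b \<in> B" "lo b > 0" using some_pos by auto
  then show ?thesis using bounds by (intro sum_pos2[of B b]) auto
qed

lemma payment_bounds:
  assumes "M \<in> mechanisms V" "v \<in> V"
  shows "0 \<le> snd M v" "snd M v \<le> (\<Sum>b\<in>B. hi b)"
proof -
  obtain q t where M: "M = (q, t)" by force
  show "0 \<le> snd M v"
    using assms by (auto simp: M mechanisms_def is_mechanism_def)
  have "t v \<le> q v \<bullet> v"
    using assms by (auto simp: M mechanisms_def individually_rational_def)
  also have "\<dots> \<le> (\<Sum>j\<in>UNIV. v $ j)"
    unfolding inner_vec_def using assms
    by (intro sum_mono)
      (auto simp: M mechanisms_def is_mechanism_def bundle_valuations_def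
        intro: mult_left_le_one_le)
  also have "\<dots> \<le> (\<Sum>b\<in>B. hi b)"
    unfolding sum_bundles using assms(2) by (intro sum_mono) (auto simp: bundle_valuations_def)
  finally show "snd M v \<le> (\<Sum>b\<in>B. hi b)" by (simp add: M)
qed

lemma space_distribution: "F \<in> distributions V \<Longrightarrow> space F = V"
  using sets_eq_imp_space_eq[of F "restrict_space borel V"]
  by (simp add: distributions_def space_restrict_space)

lemma integrable_payment:
  assumes "M \<in> mechanisms V" "F \<in> distributions V"
  shows "integrable F (snd M)"
proof -
  interpret prob_space F using assms by (simp add: distributions_def)
  have "snd M \<in> borel_measurable F"
    using assms measurable_cong_sets[of F "restrict_space borel V" borel borel]
    by (auto simp: mechanisms_def is_mechanism_def distributions_def)
  then show ?thesis
    using payment_bounds[OF assms(1)] space_distribution[OF assms(2)]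
    by (intro integrable_const_bound[where B = "\<Sum>b\<in>B. hi b"]) auto
qed

lemma revenue_bounds:
  assumes "M \<in> mechanisms V" "F \<in> distributions V"
  shows "0 \<le> revenue M F" "revenue M F \<le> (\<Sum>b\<in>B. hi b)"
proof -
  interpret prob_space F using assms by (simp add: distributions_def)
  show "0 \<le> revenue M F"
    unfolding revenue_def using payment_bounds[OF assms(1)] space_distribution[OF assms(2)]
    by (intro Bochner_Integration.integral_nonneg) auto
  have "(\<integral>v. snd M v \<partial>F) \<le> (\<integral>v. (\<Sum>b\<in>B. hi b) \<partial>F)"
    using payment_bounds[OF assms(1)] space_distribution[OF assms(2)]
    by (intro integral_mono integrable_payment assms) auto
  then show "revenue M F \<le> (\<Sum>b\<in>B. hi b)" by (simp add: revenue_def prob_space)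
qed

lemma bdd_above_revenue:
  "F \<in> distributions V \<Longrightarrow> bdd_above ((\<lambda>M. revenue M F) ` mechanisms V)"
  using revenue_bounds by (intro bdd_aboveI2) blast

lemma grand_bundle_mechanism: "(\<lambda>_. \<chi> _. 1, \<lambda>_. \<Sum>b\<in>B. lo b) \<in> mechanisms V"
proof -
  have "(\<Sum>b\<in>B. lo b) \<le> (\<Sum>j\<in>UNIV. v $ j)" if "v \<in> V" for v
    unfolding sum_bundles using that by (intro sum_mono) (auto simp: bundle_valuations_def)
  then show ?thesis using sum_lo_pos
    by (auto simp: mechanisms_def is_mechanism_def incentive_compatible_def
        individually_rational_def inner_vec_def)
qed

lemma optimal_revenue_pos:
  assumes "F \<in> distributions V"
  shows "0 < optimal_revenue V F"
proof -
  interpret prob_space F using assms by (simp add: distributions_def)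
  have "(\<Sum>b\<in>B. lo b) = revenue (\<lambda>_. \<chi> _. 1, \<lambda>_. \<Sum>b\<in>B. lo b) F"
    by (simp add: revenue_def prob_space)
  also have "\<dots> \<le> optimal_revenue V F"
    unfolding optimal_revenue_def
    by (intro cSUP_upper bdd_above_revenue assms grand_bundle_mechanism)
  finally show ?thesis using sum_lo_pos by simp
qed

lemma bundle_valuations_nonempty: "V \<noteq> {}"
proof -
  define v :: "real ^ 'n" where "v = (\<chi> j. hi (bundle_of B j) / card (bundle_of B j))"
  have bundle_of: "bundle_of B j = b" if "b \<in> B" "j \<in> b" for b j
    unfolding bundle_of_def using that partition
    by (intro the_equality) (auto simp: partition_on_def disjoint_def)
  have in_B: "bundle_of B j \<in> B" for j
  proof -
    obtain b where "b \<in> B" "j \<in> b" using partition by (auto simp: partition_on_def)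
    then show ?thesis using bundle_of by simp
  qed
  have "(\<Sum>j\<in>b. v $ j) = hi b" if "b \<in> B" for b
  proof -
    have "b \<noteq> {}" using that partition by (auto simp: partition_on_def)
    moreover have "(\<Sum>j\<in>b. v $ j) = (\<Sum>j\<in>b. hi b / card b)"
      using bundle_of[OF that] by (intro sum.cong) (auto simp: v_def)
    ultimately show ?thesis by simp
  qed
  moreover have "0 \<le> v $ j" for j
    using bounds[OF in_B[of j]] by (simp add: v_def)
  ultimately have "v \<in> V" using bounds by (auto simp: bundle_valuations_def)
  then show ?thesis by blast
qed

lemma distributions_nonempty: "distributions V \<noteq> {}"
proof -
  obtain v where "v \<in> V" using bundle_valuations_nonempty by blast
  then have "return (restrict_space borel V) v \<in> distributions V"
    by (auto simp: distributions_def space_restrict_space intro: prob_space_return)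
  then show ?thesis by blast
qed

lemma ratio_bounds:
  assumes "M \<in> mechanisms V" "F \<in> distributions V"
  shows "revenue M F / optimal_revenue V F \<in> {0..1}"
proof -
  have "revenue M F \<le> optimal_revenue V F"
    unfolding optimal_revenue_def by (intro cSUP_upper bdd_above_revenue assms)
  then show ?thesis using revenue_bounds(1)[OF assms] optimal_revenue_pos[OF assms(2)] by simp
qed

end

end

theory Submission
  imports Defs
begin

text \<open>Write \<open>c\<^sub>b\<close> for the maximum of \<open>lo b\<close> and \<open>exp (- 1 / \<gamma>) * hi b\<close>. The equation for \<open>\<gamma>\<close> says that
  \<open>\<Sum>c\<^sub>b = \<gamma> * \<Sum>c\<^sub>b * (1 + ln (hi b / c\<^sub>b))\<close>. For a root \<open>\<gamma>\<close>, the constant terms of the bundle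
  prices cancel, so the mechanism charges at least \<open>\<gamma>\<close> times the total value at every valuation,
  and the optimal revenue never exceeds the expected total value.

  Conversely, the optimal revenue at a point mass is the total value, so a mechanism of ratio \<open>r\<close>
  charges at least \<open>r\<close> times the total value everywhere. Along the path on which bundle \<open>b\<close> has value
  \<open>min (s * c\<^sub>b) (hi b)\<close>, \<open>s \<ge> 1\<close>, weighted by the equal-revenue density \<open>1 / s\<^sup>2\<close>, the virtual value
  of a bundle vanishes until the bundle reaches \<open>hi b\<close>. Hence the weighted payments are at most
  \<open>\<Sum>c\<^sub>b\<close>, while the weighted total value is \<open>\<Sum>c\<^sub>b * (1 + ln (hi b / c\<^sub>b))\<close>, and \<open>r \<le> \<gamma>\<close>.\<close>

section \<open>Upper bound along a truncated ray\<close>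

text \<open>For \<open>s \<ge> 1\<close> and \<open>m \<ge> 1\<close>, this is the integral of \<open>min \<sigma> m / \<sigma>\<^sup>2\<close> over \<open>\<sigma>\<close> from \<open>1\<close> to \<open>s\<close>.\<close>

definition ray_weight :: "real \<Rightarrow> real \<Rightarrow> real" where
  "ray_weight m s = 1 + ln (min s m) - min 1 (m / s)"

text \<open>The integrand \<open>min \<sigma> m / \<sigma>\<^sup>2\<close> decreases in
  \<open>\<sigma>\<close>, so its integral from \<open>s\<close> to \<open>\<rho> * s\<close> is at
  most the length \<open>(\<rho> - 1) * s\<close> times its value at \<open>s\<close>. The cases
  locate the cap \<open>m\<close> relative to this interval.\<close>

lemma ray_weight_step:
  assumes "1 \<le> s" "1 \<le> \<rho>" "1 \<le> m"
  shows "ray_weight m (\<rho> * s) - ray_weight m s \<le> (\<rho> - 1) * min 1 (m / s)"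
proof -
  have le: "s \<le> \<rho> * s" using assms by (simp add: mult_le_cancel_right1)
  have ln_rho: "ln \<rho> \<le> \<rho> - 1" using assms by (intro ln_le_minus_one) auto
  consider "\<rho> * s \<le> m" | "s \<le> m" "m < \<rho> * s" | "m < s" by linarith
  then show ?thesis
  proof cases
    case 1
    then have "min s m = s" "min (\<rho> * s) m = \<rho> * s" "min 1 (m / s) = 1" "min 1 (m / (\<rho> * s)) = 1"
      using le order_trans[OF le 1] assms by (auto simp: min_def field_simps)
    then show ?thesis using ln_rho assms by (simp add: ray_weight_def ln_mult)
  next
    case 2
    then have eq: "min s m = s" "min (\<rho> * s) m = m" "min 1 (m / s) = 1"
        "min 1 (m / (\<rho> * s)) = m / (\<rho> * s)"
      using le assms by (auto simp: min_def field_simps)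
    have "ln m - ln s = ln (m / s)" using assms by (simp add: ln_div)
    also have "\<dots> \<le> m / s - 1" using assms by (intro ln_le_minus_one) auto
    finally have "ray_weight m (\<rho> * s) - ray_weight m s \<le> m / s - m / (\<rho> * s)"
      unfolding ray_weight_def eq by simp
    also have "\<dots> = (m / (\<rho> * s)) * (\<rho> - 1)" using assms by (simp add: field_simps)
    also have "\<dots> \<le> 1 * (\<rho> - 1)" using assms 2 by (intro mult_right_mono) (auto simp: field_simps)
    finally show ?thesis unfolding eq by simp
  next
    case 3
    then have eq: "min s m = m" "min (\<rho> * s) m = m" "min 1 (m / s) = m / s"
        "min 1 (m / (\<rho> * s)) = m / (\<rho> * s)"
      using le less_le_trans[OF 3 le] assms by (auto simp: min_def field_simps)
    have "ray_weight m (\<rho> * s) - ray_weight m s = (m / s) * ((\<rho> - 1) / \<rho>)"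
      unfolding ray_weight_def eq using assms by (simp add: field_simps)
    also have "\<dots> \<le> (m / s) * (\<rho> - 1)"
      using assms by (intro mult_left_mono) (auto simp: pos_divide_le_eq mult_le_cancel_left1)
    finally show ?thesis unfolding eq by (simp add: mult.commute)
  qed
qed

text \<open>The coordinates of the allocation need not be measurable, so the integral against
  \<open>1 / s\<^sup>2\<close> is replaced by a telescoping sum over the geometric grid \<open>1, \<rho>, \<rho>\<^sup>2, \<dots>\<close>, with \<open>\<rho> \<rightarrow> 1\<close>.\<close>

lemma truncated_ray_bound:
  fixes a h :: "'n::finite \<Rightarrow> real"
  assumes M: "(q, t) \<in> mechanisms V"
    and ray: "\<And>s. 1 \<le> s \<Longrightarrow> (\<chi> j. min (s * a j) (h j)) \<in> V"
    and a: "\<And>j. 0 < a j" "\<And>j. a j \<le> h j"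
    and r: "0 \<le> r" "\<And>v. v \<in> V \<Longrightarrow> r * (\<Sum>j\<in>UNIV. v $ j) \<le> t v"
  shows "r * (\<Sum>j\<in>UNIV. a j * (1 + ln (h j / a j))) \<le> (\<Sum>j\<in>UNIV. a j)"
proof -
  define m where "m j = h j / a j" for j
  have m: "1 \<le> m j" for j using a[of j] by (simp add: m_def)
  define x :: "real \<Rightarrow> real ^ 'n" where "x s = (\<chi> j. min (s * a j) (h j))" for s
  define X where "X s = (\<Sum>j\<in>UNIV. x s $ j)" for s
  define U where "U s = q (x s) \<bullet> x s - t (x s)" for s
  \<comment> \<open>The potential that telescopes: for a smooth path,
    \<open>U' \<ge> q \<bullet> x'\<close>, \<open>q \<le> 1\<close> and the decrease of
    \<open>x s / s\<close> make its derivative at least the payment divided by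
    \<open>s\<^sup>2\<close>.\<close>
  define G where "G s = (U s - X s) / s" for s
  define K where "K s = (\<Sum>j\<in>UNIV. a j * ray_weight (m j) s)" for s
  have x_div: "x s $ j / s = a j * min 1 (m j / s)" if "1 \<le> s" for s j
    using that a[of j] by (auto simp: x_def m_def min_def field_simps)
  have X_div: "X s / s = (\<Sum>j\<in>UNIV. a j * min 1 (m j / s))" if "1 \<le> s" for s
    using x_div[OF that] by (simp add: X_def sum_divide_distrib)
  have xV: "x s \<in> V" if "1 \<le> s" for s using ray[OF that] by (simp add: x_def)
  have q: "0 \<le> q (x s) $ j" "q (x s) $ j \<le> 1" if "1 \<le> s" for s j
    using M xV[OF that] by (auto simp: mechanisms_def is_mechanism_def)
  have rX: "r * X s \<le> q (x s) \<bullet> x s - U s" if "1 \<le> s" for s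
    using r(2)[OF xV[OF that]] by (simp add: X_def U_def)
  \<comment> \<open>Here \<open>1 / s - 1 / s'\<close> is the integral of the equal-revenue density
    between the two points.\<close>
  have step: "r * (1 / s - 1 / s') * X s \<le> G s' - G s" if s: "1 \<le> s" "s \<le> s'" for s s'
  proof -
    have s': "1 \<le> s'" using s by simp
    have "q (x s) \<bullet> x s' - t (x s) \<le> q (x s') \<bullet> x s' - t (x s')"
      using M xV[OF s(1)] xV[OF s'] by (auto simp: mechanisms_def incentive_compatible_def)
    then have IC: "q (x s) \<bullet> (x s' - x s) \<le> U s' - U s"
      by (simp add: U_def inner_diff_right)
    \<comment> \<open>Relative to \<open>s\<close> no coordinate grows along the ray, so the
      differences below are nonnegative and the weights \<open>q \<le> 1\<close> can only shrink
      them.\<close>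
    have antimono: "x s' $ j / s' \<le> x s $ j / s" for j
      unfolding x_div[OF s(1)] x_div[OF s']
      using a[of j] m[of j] s by (intro mult_left_mono min.mono) (auto intro!: divide_left_mono)
    have "(\<Sum>j\<in>UNIV. q (x s) $ j * (x s $ j / s - x s' $ j / s'))
        \<le> (\<Sum>j\<in>UNIV. x s $ j / s - x s' $ j / s')"
      using antimono q[OF s(1)] by (intro sum_mono mult_left_le_one_le) auto
    then have virtual: "q (x s) \<bullet> x s / s - q (x s) \<bullet> x s' / s' \<le> X s / s - X s' / s'"
      by (simp add: inner_vec_def X_def sum_divide_distrib sum_subtractf right_diff_distrib)
    have "r * (1 / s - 1 / s') * X s \<le> (1 / s - 1 / s') * (q (x s) \<bullet> x s - U s)"
      using mult_left_mono[OF rX[OF s(1)], of "1 / s - 1 / s'"] s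
      by (simp add: divide_left_mono mult.assoc mult.left_commute)
    \<comment> \<open>Summation by parts: the drop of \<open>1 / s\<close> becomes a drop of
      \<open>x s / s\<close> plus a growth of \<open>x\<close>, which incentive compatibility
      controls.\<close>
    also have "\<dots> = q (x s) \<bullet> x s / s - q (x s) \<bullet> x s' / s' + q (x s) \<bullet> (x s' - x s) / s'
        - (1 / s - 1 / s') * U s"
      by (simp add: inner_diff_right algebra_simps diff_divide_distrib)
    also have "\<dots> \<le> (X s / s - X s' / s') + (U s' - U s) / s' - (1 / s - 1 / s') * U s"
      using virtual IC s' by (intro diff_right_mono add_mono divide_right_mono) auto
    also have "\<dots> = G s' - G s" by (simp add: G_def diff_divide_distrib algebra_simps)
    finally show ?thesis .
  qed
  \<comment> \<open>The loss \<open>1 / \<rho>\<close> comes from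
    \<open>1 / s - 1 / (\<rho> * s) = (\<rho> - 1) / (\<rho> * s)\<close> and disappears as the grid
    is refined.\<close>
  have geometric: "r / \<rho> * (K (\<rho> * s) - K s) \<le> G (\<rho> * s) - G s" if "1 \<le> s" "1 \<le> \<rho>" for s \<rho>
  proof -
    have "K (\<rho> * s) - K s = (\<Sum>j\<in>UNIV. a j * (ray_weight (m j) (\<rho> * s) - ray_weight (m j) s))"
      by (simp add: K_def sum_subtractf right_diff_distrib)
    also have "\<dots> \<le> (\<Sum>j\<in>UNIV. a j * ((\<rho> - 1) * min 1 (m j / s)))"
      using a(1) m that by (intro sum_mono mult_left_mono ray_weight_step) (auto intro: less_imp_le)
    also have "\<dots> = (\<rho> - 1) * (X s / s)"
      unfolding X_div[OF that(1)] sum_distrib_left by (simp add: mult.left_commute)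
    finally have "r / \<rho> * (K (\<rho> * s) - K s) \<le> r / \<rho> * ((\<rho> - 1) * (X s / s))"
      using r that by (intro mult_left_mono) auto
    also have "\<dots> = r * (1 / s - 1 / (\<rho> * s)) * X s" using that by (simp add: field_simps)
    also have "\<dots> \<le> G (\<rho> * s) - G s"
      using that by (intro step) (auto simp: mult_le_cancel_right1)
    finally show ?thesis .
  qed
  have powers: "r / \<rho> * (K (\<rho> ^ n) - K 1) \<le> G (\<rho> ^ n) - G 1" if "1 \<le> \<rho>" for \<rho> n
  proof (induction n)
    case (Suc n)
    from geometric[OF one_le_power[OF that, of n] that] Suc show ?case
      by (simp add: right_diff_distrib)
  qed simp
  have X1: "X 1 = (\<Sum>j\<in>UNIV. a j)" using a by (simp add: X_def x_def min_def)
  have K1: "K 1 = 0" using m by (simp add: K_def ray_weight_def min_def)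
  have G1: "- X 1 \<le> G 1"
    using M xV[of 1] by (auto simp: G_def U_def mechanisms_def individually_rational_def)
  \<comment> \<open>Any end point beyond all \<open>m j\<close> serves: there every coordinate has
    reached its cap \<open>h j\<close>.\<close>
  define S where "S = (\<Sum>j\<in>UNIV. m j)"
  have mS: "m j \<le> S" for j
    unfolding S_def using m by (intro member_le_sum) (auto intro: order_trans[OF zero_le_one])
  have S: "1 \<le> S" using m mS order_trans by blast
  have x_nonneg: "0 \<le> x S $ j" for j
    using a[of j] S by (simp add: x_def)
  \<comment> \<open>The end point carries the remaining weight \<open>1 / S\<close>, the integral of
    the density over the constant rest of the ray.\<close>
  have GS: "G S \<le> - (r * (X S / S))"
  proof -
    have "q (x S) \<bullet> x S \<le> X S"
      unfolding X_def inner_vec_def inner_real_def using q[OF S] x_nonneg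
      by (intro sum_mono mult_left_le_one_le) auto
    then have "U S - X S \<le> - (r * X S)" using rX[OF S] by simp
    from divide_right_mono[OF this, of S] S show ?thesis by (simp add: G_def)
  qed
  \<comment> \<open>The grid ratio is the \<open>Suc n\<close>-th root of \<open>S\<close>, so the
    grid ends exactly at \<open>S\<close>; \<open>Suc\<close> avoids division by zero.\<close>
  have bound: "r / exp (ln S / Suc n) * K S + r * (X S / S) \<le> (\<Sum>j\<in>UNIV. a j)" for n
  proof -
    have "exp (ln S / Suc n) ^ Suc n = S"
      using S by (subst exp_of_nat_mult[symmetric]) simp
    then show ?thesis
      using powers[of "exp (ln S / Suc n)" "Suc n"] S K1 G1 GS X1 by simp
  qed
  have "(\<lambda>n. r / exp (ln S / Suc n) * K S + r * (X S / S)) \<longlonglongrightarrow> r / exp 0 * K S + r * (X S / S)"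
    by (intro tendsto_intros LIMSEQ_ignore_initial_segment
        filterlim_compose[OF lim_const_over_n filterlim_Suc]) auto
  then have "r * (K S + X S / S) \<le> (\<Sum>j\<in>UNIV. a j)"
    using LIMSEQ_le_const2 bound by (fastforce simp: algebra_simps)
  \<comment> \<open>The terms \<open>min 1 (m j / S)\<close> cancel, and
    \<open>min S (m j) = m j\<close>.\<close>
  moreover have "K S + X S / S = (\<Sum>j\<in>UNIV. a j * (1 + ln (h j / a j)))"
    unfolding X_div[OF S] K_def sum.distrib[symmetric]
    using mS by (intro sum.cong refl)
      (simp add: ray_weight_def min_absorb2 distrib_left[symmetric] m_def[symmetric])
  ultimately show ?thesis by simp
qed

section \<open>Bundle-wise separable mechanisms\<close>

text \<open>The allocation \<open>\<gamma> * ln (w / hi b) + 1\<close> vanishes at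
  \<open>w = exp (- 1 / \<gamma>) * hi b\<close>; the cutoff is this threshold, raised to the
  feasible range if necessary.\<close>

definition cutoff :: "('n set \<Rightarrow> real) \<Rightarrow> ('n set \<Rightarrow> real) \<Rightarrow> real \<Rightarrow> 'n set \<Rightarrow> real" where
  "cutoff lo hi \<gamma> b = max (lo b) (exp (- 1 / \<gamma>) * hi b)"

section \<open>Bundle sums and elementary payment bounds\<close>

context bundle_bounds
begin

lemma bundle_of_eq: "b \<in> B \<Longrightarrow> j \<in> b \<Longrightarrow> bundle_of B j = b"
  unfolding bundle_of_def using partition
  by (intro the_equality) (auto simp: partition_on_def disjoint_def)

lemma bundle_of_in: "bundle_of B j \<in> B" "j \<in> bundle_of B j"
proof -
  obtain b where "b \<in> B" "j \<in> b" using partition by (auto simp: partition_on_def)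
  then show "bundle_of B j \<in> B" "j \<in> bundle_of B j" using bundle_of_eq by auto
qed

lemma card_bundle_pos: "b \<in> B \<Longrightarrow> 0 < card b"
  using partition by (auto simp: partition_on_def card_gt_0_iff)

text \<open>Carries the item-wise ray bound over to bundles by splitting each bundle quantity
  equally among its items.\<close>

lemma sum_spread:
  assumes "b \<in> B"
  shows "(\<Sum>j\<in>b. f (bundle_of B j) / card (bundle_of B j)) = (f b :: real)"
proof -
  have "(\<Sum>j\<in>b. f (bundle_of B j) / card (bundle_of B j)) = (\<Sum>j\<in>b. f b / card b)"
    using bundle_of_eq[OF assms] by (intro sum.cong) auto
  then show ?thesis using card_bundle_pos[OF assms] by (cases "b = {}") auto
qed

lemma bundle_sum_range:
  assumes "v \<in> V" "b \<in> B"
  shows "lo b \<le> (\<Sum>j\<in>b. v $ j)" "(\<Sum>j\<in>b. v $ j) \<le> hi b" "0 \<le> (\<Sum>j\<in>b. v $ j)"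
  using assms by (auto simp: bundle_valuations_def intro: sum_nonneg)

lemma sum_valuation_pos:
  assumes "v \<in> V"
  shows "0 < (\<Sum>j\<in>UNIV. v $ j)"
proof -
  have "(\<Sum>b\<in>B. lo b) \<le> (\<Sum>j\<in>UNIV. v $ j)"
    unfolding sum_bundles using assms by (intro sum_mono) (auto simp: bundle_valuations_def)
  then show ?thesis using sum_lo_pos by simp
qed

lemma payment_le_sum:
  assumes "M \<in> mechanisms V" "v \<in> V"
  shows "snd M v \<le> (\<Sum>j\<in>UNIV. v $ j)"
proof -
  obtain q t where M: "M = (q, t)" by force
  have "t v \<le> q v \<bullet> v"
    using assms by (auto simp: M mechanisms_def individually_rational_def)
  also have "\<dots> \<le> (\<Sum>j\<in>UNIV. v $ j)"
    unfolding inner_vec_def using assms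
    by (intro sum_mono)
      (auto simp: M mechanisms_def is_mechanism_def bundle_valuations_def
        intro: mult_left_le_one_le)
  finally show ?thesis by (simp add: M)
qed

section \<open>Approximation ratio versus payments at single valuations\<close>

lemma posted_price_mechanism:
  assumes "0 \<le> p"
  shows "(\<lambda>v. \<chi> _. if p \<le> (\<Sum>j\<in>UNIV. v $ j) then 1 else 0,
      \<lambda>v. if p \<le> (\<Sum>j\<in>UNIV. v $ j) then p else 0) \<in> mechanisms V"
proof -
  have "(\<lambda>v :: real ^ 'n. if p \<le> (\<Sum>j\<in>UNIV. v $ j) then p else 0)
      \<in> borel_measurable (restrict_space borel V)"
    by (intro measurable_restrict_space1) measurable
  then show ?thesis using assms
    by (auto simp: mechanisms_def is_mechanism_def incentive_compatible_def
        individually_rational_def inner_vec_def)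
qed

text \<open>Tests the ratio against the point mass at \<open>v\<close>, where the grand bundle
  posted at its total value earns all of it.\<close>

lemma approx_ratio_mult_le_payment:
  assumes "M \<in> mechanisms V" "v \<in> V"
  shows "approx_ratio V M * (\<Sum>j\<in>UNIV. v $ j) \<le> snd M v"
proof -
  define F where "F = return (restrict_space borel V) v"
  define p where "p = (\<Sum>j\<in>UNIV. v $ j)"
  have p: "0 < p" using sum_valuation_pos[OF assms(2)] by (simp add: p_def)
  have F: "F \<in> distributions V"
    using assms(2) by (auto simp: F_def distributions_def space_restrict_space
        intro: prob_space_return)
  have rev: "revenue M' F = snd M' v" if "M' \<in> mechanisms V" for M'
    unfolding revenue_def F_def using that assms(2)
    by (intro integral_return)
      (auto simp: space_restrict_space mechanisms_def is_mechanism_def)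
  have "p \<le> optimal_revenue V F"
    unfolding optimal_revenue_def
    using posted_price_mechanism[of p] p
    by (intro cSUP_upper2[OF bdd_above_revenue[OF F]]) (auto simp: rev p_def)
  moreover have "0 \<le> snd M v" using payment_bounds(1)[OF assms] .
  ultimately have "snd M v / optimal_revenue V F \<le> snd M v / p"
    using p by (intro divide_left_mono) auto
  moreover have "approx_ratio V M \<le> revenue M F / optimal_revenue V F"
    unfolding approx_ratio_def using ratio_bounds[OF assms(1)] F
    by (intro cINF_lower bdd_belowI2[where m = 0]) auto
  ultimately have "approx_ratio V M \<le> snd M v / p" using rev[OF assms(1)] by simp
  then show ?thesis using p by (simp add: p_def field_simps)
qed

text \<open>Individual rationality caps the payment of every competitor by the total value, so the
  pointwise bound integrates against every distribution.\<close>

lemma approx_ratio_ge: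
  assumes "M \<in> mechanisms V" "0 \<le> r"
    and "\<And>v. v \<in> V \<Longrightarrow> r * (\<Sum>j\<in>UNIV. v $ j) \<le> snd M v"
  shows "r \<le> approx_ratio V M"
  unfolding approx_ratio_def
proof (rule cINF_greatest[OF distributions_nonempty])
  fix F assume F: "F \<in> distributions V"
  have "r * revenue M' F \<le> revenue M F" if M': "M' \<in> mechanisms V" for M'
  proof -
    have "r * snd M' v \<le> snd M v" if "v \<in> V" for v
      using mult_left_mono[OF payment_le_sum[OF M' that] assms(2)] assms(3)[OF that] by simp
    then have "(\<integral>v. r * snd M' v \<partial>F) \<le> (\<integral>v. snd M v \<partial>F)"
      using space_distribution[OF F] integrable_payment[OF M' F] integrable_payment[OF assms(1) F]
      by (intro integral_mono) auto
    then show ?thesis by (simp add: revenue_def)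
  qed
  note le = this
  have "r * optimal_revenue V F \<le> revenue M F"
  proof (cases "r = 0")
    case False
    then have "optimal_revenue V F \<le> revenue M F / r"
      unfolding optimal_revenue_def using le assms(1,2)
      by (intro cSUP_least) (auto simp: field_simps)
    then show ?thesis using False assms(2) by (simp add: field_simps)
  qed (use revenue_bounds[OF assms(1) F] in simp)
  then show "r \<le> revenue M F / optimal_revenue V F"
    using optimal_revenue_pos[OF F] by (simp add: field_simps)
qed

section \<open>Cutoffs, the equation for \<open>\<gamma>\<close>, and the upper bound on the
  ratio\<close>

lemma cutoff_bounds:
  assumes "b \<in> B" "0 < \<gamma>"
  shows "0 < cutoff lo hi \<gamma> b" "lo b \<le> cutoff lo hi \<gamma> b" "cutoff lo hi \<gamma> b \<le> hi b"
proof -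
  have "exp (- 1 / \<gamma>) * hi b \<le> 1 * hi b"
    using assms bounds[OF assms(1)] by (intro mult_right_mono) auto
  then show "0 < cutoff lo hi \<gamma> b" "lo b \<le> cutoff lo hi \<gamma> b" "cutoff lo hi \<gamma> b \<le> hi b"
    using bounds[OF assms(1)] by (auto simp: cutoff_def less_max_iff_disj)
qed

lemma low_bundles_eq:
  "low_bundles B lo hi \<gamma> = {b \<in> B. lo b < exp (- 1 / \<gamma>) * hi b}"
proof -
  have "ext_ln (lo b / hi b) < ereal (- 1 / \<gamma>) \<longleftrightarrow> lo b < exp (- 1 / \<gamma>) * hi b" if "b \<in> B" for b
  proof (cases "lo b = 0")
    case True
    then show ?thesis using bounds[OF that] by (simp add: ext_ln_def)
  next
    case False
    then have pos: "0 < lo b / hi b" using bounds[OF that] by simp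
    have "ln (lo b / hi b) < - 1 / \<gamma> \<longleftrightarrow> lo b / hi b < exp (- 1 / \<gamma>)"
      using pos by (metis exp_less_cancel_iff exp_ln)
    then show ?thesis using False bounds[OF that] by (simp add: ext_ln_def pos_divide_less_eq)
  qed
  then show ?thesis by (auto simp: low_bundles_def)
qed

text \<open>On low bundles \<open>ln (hi b / c) = 1 / \<gamma>\<close> for the cutoff
  \<open>c\<close>, so the summand is \<open>\<gamma> * c\<close>; on the others
  \<open>c = lo b\<close>. The single formula hides the jumps of \<open>low_bundles\<close> and is
  visibly continuous in \<open>\<gamma>\<close>.\<close>

lemma ratio_eqn_eq:
  assumes "0 < \<gamma>"
  shows "ratio_eqn B lo hi \<gamma> = (\<Sum>b\<in>B.
    \<gamma> * (cutoff lo hi \<gamma> b * (1 + ln (hi b / cutoff lo hi \<gamma> b))) - cutoff lo hi \<gamma> b)"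
    (is "_ = (\<Sum>b\<in>B. ?f b)")
proof -
  let ?S = "low_bundles B lo hi \<gamma>"
  have "?f b = \<gamma> * exp (- 1 / \<gamma>) * hi b" if "b \<in> ?S" for b
  proof -
    have "b \<in> B" "cutoff lo hi \<gamma> b = exp (- 1 / \<gamma>) * hi b"
      using that by (auto simp: low_bundles_eq cutoff_def)
    moreover have "hi b / (exp (- 1 / \<gamma>) * hi b) = exp (1 / \<gamma>)"
      using bounds[OF \<open>b \<in> B\<close>] by (simp add: exp_minus field_simps)
    ultimately show ?thesis using assms by (simp add: field_simps)
  qed
  then have 1: "(\<Sum>b\<in>?S. ?f b) = \<gamma> * exp (- 1 / \<gamma>) * (\<Sum>b\<in>?S. hi b)"
    by (simp add: sum_distrib_left)
  have "?f b = - (lo b * (\<gamma> * ln (lo b / hi b) - \<gamma> + 1))" if "b \<in> B - ?S" for b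
  proof -
    have b: "b \<in> B" "exp (- 1 / \<gamma>) * hi b \<le> lo b" using that by (auto simp: low_bundles_eq)
    moreover from b have c: "cutoff lo hi \<gamma> b = lo b" by (simp add: cutoff_def)
    moreover have "0 < lo b" "0 < hi b" using c cutoff_bounds[OF b(1) assms] by auto
    ultimately show ?thesis by (simp add: ln_div algebra_simps)
  qed
  then have 2: "(\<Sum>b\<in>B - ?S. ?f b)
      = - (\<Sum>b\<in>B - ?S. lo b * (\<gamma> * ln (lo b / hi b) - \<gamma> + 1))"
    by (simp add: sum_negf)
  have "?S \<subseteq> B" by (auto simp: low_bundles_def)
  then have "(\<Sum>b\<in>B. ?f b) = (\<Sum>b\<in>B - ?S. ?f b) + (\<Sum>b\<in>?S. ?f b)"
    by (intro sum.subset_diff) auto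
  then show ?thesis unfolding 1 2 ratio_eqn_def by linarith
qed

lemma approx_ratio_le:
  assumes "M \<in> mechanisms V" "0 < \<gamma>" "ratio_eqn B lo hi \<gamma> = 0"
  shows "approx_ratio V M \<le> \<gamma>"
proof (cases "0 \<le> approx_ratio V M")
  case True
  let ?c = "cutoff lo hi \<gamma>" and ?r = "approx_ratio V M" and ?b = "bundle_of B"
  \<comment> \<open>With equal splitting all items of a bundle reach their caps at the same
    \<open>s\<close>, so \<open>h j / a j\<close> depends on the bundle only.\<close>
  define a where "a j = ?c (?b j) / card (?b j)" for j
  define h where "h j = hi (?b j) / card (?b j)" for j
  note c = cutoff_bounds[OF _ assms(2)]
  have card: "0 < card (?b j)" for j by (rule card_bundle_pos[OF bundle_of_in(1)])
  have a: "0 < a j" "a j \<le> h j" for j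
    using c[OF bundle_of_in(1), of j] card[of j] by (auto simp: a_def h_def intro: divide_right_mono)
  have ray: "(\<chi> j. min (s * a j) (h j)) \<in> V" if "1 \<le> s" for s
  proof -
    have eq: "min (s * a j) (h j) = min (s * ?c (?b j)) (hi (?b j)) / card (?b j)" for j
      using card[of j] by (auto simp: a_def h_def min_def field_simps)
    have "?c b \<le> s * ?c b" if "b \<in> B" for b
      using c[OF that] \<open>1 \<le> s\<close> by (simp add: mult_le_cancel_right1)
    then have "lo b \<le> min (s * ?c b) (hi b)" if "b \<in> B" for b
      using c(2)[OF that] bounds[OF that] that order_trans by (fastforce intro: min.boundedI)
    moreover have "0 \<le> min (s * a j) (h j)" for j
      using a[of j] that by (auto simp: min_def)
    ultimately show ?thesis
      by (auto simp: bundle_valuations_def eq sum_spread[where f = "\<lambda>b. min (s * ?c b) (hi b)"])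
  qed
  obtain q t where M: "M = (q, t)" by force
  have "?r * (\<Sum>j\<in>UNIV. a j * (1 + ln (h j / a j))) \<le> (\<Sum>j\<in>UNIV. a j)"
    using truncated_ray_bound[of q t V a h ?r, OF _ ray a True]
      approx_ratio_mult_le_payment[OF assms(1)] assms(1) by (simp add: M)
  moreover have "(\<Sum>j\<in>UNIV. a j) = (\<Sum>b\<in>B. ?c b)"
    by (simp add: sum_bundles a_def sum_spread)
  moreover have "a j * (1 + ln (h j / a j))
      = ?c (?b j) * (1 + ln (hi (?b j) / ?c (?b j))) / card (?b j)" for j
    using card[of j] by (simp add: a_def h_def)
  then have "(\<Sum>j\<in>UNIV. a j * (1 + ln (h j / a j))) = (\<Sum>b\<in>B. ?c b * (1 + ln (hi b / ?c b)))"
    by (simp add: sum_bundles sum_spread[where f = "\<lambda>b. ?c b * (1 + ln (hi b / ?c b))"])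
  moreover have "(\<Sum>b\<in>B. ?c b) = \<gamma> * (\<Sum>b\<in>B. ?c b * (1 + ln (hi b / ?c b)))"
    using assms(3) unfolding ratio_eqn_eq[OF assms(2)] sum_subtractf sum_distrib_left by simp
  moreover have "0 < (\<Sum>b\<in>B. ?c b * (1 + ln (hi b / ?c b)))"
  proof (rule sum_pos)
    show "B \<noteq> {}" using partition by (auto simp: partition_on_def)
    show "0 < ?c b * (1 + ln (hi b / ?c b))" if "b \<in> B" for b
      using c[OF that] by (intro mult_pos_pos add_pos_nonneg) auto
  qed simp
  ultimately show ?thesis by simp
qed (use assms(2) in simp)

end

text \<open>Since \<open>\<gamma> * ln x + 1 = 0\<close> at \<open>x = exp (- 1 / \<gamma>)\<close>,
  the positive part can be moved inside the logarithm as a lower clamp on the bundle value, which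
  also absorbs the value \<open>0\<close>.\<close>

lemma bundle_alloc_eq:
  assumes "0 < \<gamma>" "0 < hi (bundle_of B j)"
    and "0 \<le> (\<Sum>i\<in>bundle_of B j. v $ i)"
  shows "bundle_alloc B hi \<gamma> v $ j = \<gamma> * ln (max (\<Sum>i\<in>bundle_of B j. v $ i)
    (exp (- 1 / \<gamma>) * hi (bundle_of B j)) / hi (bundle_of B j)) + 1"
proof -
  define w where "w = (\<Sum>i\<in>bundle_of B j. v $ i)"
  define H where "H = hi (bundle_of B j)"
  have H: "0 < H" and w: "0 \<le> w" using assms by (auto simp: H_def w_def)
  have "real_of_ereal (max 0 (ereal \<gamma> * ext_ln (w / H) + 1))
      = \<gamma> * ln (max w (exp (- 1 / \<gamma>) * H) / H) + 1"
  proof (cases "w = 0")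
    case True
    then have "max w (exp (- 1 / \<gamma>) * H) / H = exp (- 1 / \<gamma>)" using H by (simp add: max_def)
    then show ?thesis using True assms(1) by (simp add: ext_ln_def)
  next
    case False
    then have pos: "0 < w / H" using H w by simp
    have "ereal \<gamma> * ext_ln (w / H) + 1 = ereal (\<gamma> * ln (w / H) + 1)"
      using pos False H by (simp add: ext_ln_def one_ereal_def)
    then have "real_of_ereal (max 0 (ereal \<gamma> * ext_ln (w / H) + 1)) = max 0 (\<gamma> * ln (w / H) + 1)"
      by (simp add: max_def zero_ereal_def)
    also have "\<dots> = \<gamma> * max (- 1 / \<gamma>) (ln (w / H)) + 1"
      using assms(1) by (auto simp: max_def field_simps)
    also have "max (- 1 / \<gamma>) (ln (w / H)) = ln (max (exp (- 1 / \<gamma>)) (w / H))"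
      using pos by (auto simp: max_def ln_ge_iff)
    also have "max (exp (- 1 / \<gamma>)) (w / H) = max w (exp (- 1 / \<gamma>) * H) / H"
      using H by (auto simp: max_def field_simps)
    finally show ?thesis .
  qed
  then show ?thesis by (simp add: bundle_alloc_def w_def H_def)
qed

section \<open>Incentives, ratio and parameter of the separable mechanism\<close>

context bundle_bounds
begin

text \<open>Merges both price branches; the constant is the negated summand of
  \<open>ratio_eqn_eq\<close>, so these constants sum to zero at a root.\<close>

lemma bundle_price_eq:
  assumes "b \<in> B" "0 < \<gamma>" "lo b \<le> w"
  defines "c \<equiv> cutoff lo hi \<gamma> b"
  shows "bundle_price lo hi \<gamma> b w =
    \<gamma> * max w (exp (- 1 / \<gamma>) * hi b) + c - \<gamma> * (c * (1 + ln (hi b / c)))"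
proof (cases "exp (- 1 / \<gamma>) * hi b > lo b")
  case True
  then have c: "c = exp (- 1 / \<gamma>) * hi b" by (simp add: c_def cutoff_def)
  have "hi b / c = exp (1 / \<gamma>)"
    using bounds[OF assms(1)] by (simp add: c exp_minus field_simps)
  then have "\<gamma> * (c * (1 + ln (hi b / c))) = \<gamma> * c + c" using assms(2) by (simp add: field_simps)
  moreover have "\<gamma> * max 0 (w - c) = \<gamma> * max w c - \<gamma> * c" by (simp add: max_def algebra_simps)
  ultimately show ?thesis using True by (simp add: bundle_price_def c)
next
  case False
  then have c: "c = lo b" by (simp add: c_def cutoff_def)
  have pos: "0 < lo b" "0 < hi b"
    using cutoff_bounds[OF assms(1,2)] c by (auto simp: c_def)
  have "ln (lo b / (exp 1 * hi b)) = ln (lo b) - ln (hi b) - 1"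
    using pos by (simp add: ln_div ln_mult)
  then show ?thesis
    using False assms(3) pos by (simp add: bundle_price_def c ln_div max_def algebra_simps)
qed

text \<open>Allocation and price of a bundle depend only on its own total \<open>w\<close>, so all
  conditions reduce to one-dimensional ones for \<open>Q\<close> and \<open>T\<close>.\<close>

lemma bundle_mechanism_in_mechanisms:
  assumes "0 < \<gamma>"
  shows "bundle_mechanism B lo hi \<gamma> \<in> mechanisms V"
proof -
  define R where "R b w = max w (exp (- 1 / \<gamma>) * hi b)" for b w
  define Q where "Q b w = \<gamma> * ln (R b w / hi b) + 1" for b w
  define T where "T b w = bundle_price lo hi \<gamma> b w" for b w
  define W where "W v b = (\<Sum>j\<in>b. v $ j)" for v :: "real ^ 'n" and b
  let ?c = "cutoff lo hi \<gamma>"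
  note c = cutoff_bounds[OF _ assms]
  have W: "lo b \<le> W v b" "W v b \<le> hi b" if "v \<in> V" "b \<in> B" for v b
    using bundle_sum_range[OF that] by (auto simp: W_def)
  have alloc: "bundle_alloc B hi \<gamma> v $ j = Q (bundle_of B j) (W v (bundle_of B j))" if "v \<in> V" for v j
    using bundle_alloc_eq[where v = v and j = j and B = B and hi = hi, OF assms]
      bounds[OF bundle_of_in(1), of j] bundle_sum_range[OF that bundle_of_in(1), of j]
    by (simp add: Q_def R_def W_def)
  have T_eq: "T b w = \<gamma> * R b w + ?c b - \<gamma> * (?c b * (1 + ln (hi b / ?c b)))"
    if "b \<in> B" "lo b \<le> w" for b w
    using bundle_price_eq[OF that(1) assms that(2)] by (simp add: T_def R_def)
  have R_pos: "0 < R b w" if "b \<in> B" for b w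
    using bounds[OF that] by (simp add: R_def less_max_iff_disj)
  have Q_nonneg: "0 \<le> Q b w" if "b \<in> B" for b w
  proof -
    have "exp (- 1 / \<gamma>) \<le> R b w / hi b"
      using bounds[OF that] by (simp add: R_def pos_le_divide_eq)
    then have "- 1 / \<gamma> \<le> ln (R b w / hi b)"
      using R_pos[OF that] bounds[OF that] by (simp add: ln_ge_iff)
    then show ?thesis using assms by (simp add: Q_def field_simps)
  qed
  have Q_le: "Q b w \<le> 1" if "b \<in> B" "w \<le> hi b" for b w
  proof -
    have "R b w \<le> hi b"
      using that bounds[OF that(1)] assms by (simp add: R_def)
    then have "R b w / hi b \<le> 1" using bounds[OF that(1)] by simp
    then have "ln (R b w / hi b) \<le> 0" using R_pos[OF that(1)] bounds[OF that(1)] by simp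
    then show ?thesis using assms by (simp add: Q_def mult_nonneg_nonpos)
  qed
  have dot: "bundle_alloc B hi \<gamma> v' \<bullet> v = (\<Sum>b\<in>B. Q b (W v' b) * W v b)"
    if "v' \<in> V" for v v'
  proof -
    have "bundle_alloc B hi \<gamma> v' \<bullet> v = (\<Sum>b\<in>B. \<Sum>j\<in>b. bundle_alloc B hi \<gamma> v' $ j * v $ j)"
      by (simp add: inner_vec_def sum_bundles)
    also have "\<dots> = (\<Sum>b\<in>B. \<Sum>j\<in>b. Q b (W v' b) * v $ j)"
      using alloc[OF that] bundle_of_eq by (intro sum.cong refl) simp
    finally show ?thesis by (simp add: W_def sum_distrib_left)
  qed
  have IC: "Q b w' * w - T b w' \<le> Q b w * w - T b w"
    if b: "b \<in> B" and w: "lo b \<le> w" "lo b \<le> w'" for b w w'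
  proof -
    let ?m = "R b w" and ?m' = "R b w'"
    have m: "0 < ?m" "0 < ?m'" "0 < hi b" using R_pos[OF b] bounds[OF b] by auto
    have "?m * ln (?m' / ?m) \<le> ?m * (?m' / ?m - 1)"
      using m by (intro mult_left_mono ln_le_minus_one) auto
    also have "\<dots> = ?m' - ?m" using m by (simp add: field_simps)
    finally have log_le: "?m * ln (?m' / ?m) \<le> ?m' - ?m" .
    \<comment> \<open>This is incentive compatibility divided by \<open>\<gamma>\<close>. If
      \<open>w\<close> is clamped, then \<open>w \<le> ?m\<close> and \<open>?m\<close> is the least
      value of \<open>R b\<close>, so the logarithm is nonnegative and \<open>w\<close> may be
      replaced by \<open>?m\<close>.\<close>
    have "w * ln (?m' / ?m) \<le> ?m' - ?m"
    proof (cases "w = ?m")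
      case True
      then show ?thesis using log_le by simp
    next
      case False
      then have eq: "?m = exp (- 1 / \<gamma>) * hi b" "w \<le> ?m" by (auto simp: R_def)
      then have "?m \<le> ?m'" by (simp add: R_def)
      then have "0 \<le> ln (?m' / ?m)" using m by simp
      then have "w * ln (?m' / ?m) \<le> ?m * ln (?m' / ?m)" using eq by (intro mult_right_mono)
      then show ?thesis using log_le by simp
    qed
    then have "\<gamma> * (w * ln (?m' / ?m)) \<le> \<gamma> * (?m' - ?m)" using assms by simp
    moreover have "ln (?m' / ?m) = ln (?m' / hi b) - ln (?m / hi b)" using m by (simp add: ln_div)
    ultimately have "\<gamma> * (w * (ln (?m' / hi b) - ln (?m / hi b))) \<le> \<gamma> * (?m' - ?m)" by simp
    then show ?thesis
      using w by (simp add: Q_def T_eq[OF b] algebra_simps)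
  qed
  have R_c: "R b (?c b) = ?c b" for b by (simp add: R_def cutoff_def)
  have T_c: "T b (?c b) = Q b (?c b) * ?c b" if "b \<in> B" for b
  proof -
    have "ln (?c b / hi b) = - ln (hi b / ?c b)"
      using c[OF that] bounds[OF that] by (simp add: ln_div)
    then show ?thesis
      by (simp add: T_eq[OF that c(2)[OF that]] R_c Q_def algebra_simps)
  qed
  \<comment> \<open>Together with zero utility at the cutoff, this makes the report
    \<open>?c b\<close> yield nonnegative utility to every feasible \<open>w\<close>;
    \<open>IR\<close> follows by comparison with that report.\<close>
  have Q_c: "?c b = lo b \<or> Q b (?c b) = 0" if "b \<in> B" for b
  proof -
    have "Q b (?c b) = 0" if "?c b = exp (- 1 / \<gamma>) * hi b"
      using that bounds[OF \<open>b \<in> B\<close>] assms unfolding Q_def R_c by simp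
    then show ?thesis by (auto simp: cutoff_def max_def)
  qed
  have IR: "T b w \<le> Q b w * w" if "b \<in> B" "lo b \<le> w" for b w
  proof -
    have "0 \<le> Q b (?c b) * (w - ?c b)" using Q_c[OF that(1)] Q_nonneg[OF that(1)] that(2) by auto
    also have "\<dots> = Q b (?c b) * w - T b (?c b)" by (simp add: T_c[OF that(1)] algebra_simps)
    also have "\<dots> \<le> Q b w * w - T b w" using IC[OF that(1,2) c(2)[OF that(1)]] .
    finally show ?thesis by simp
  qed
  have T_nonneg: "0 \<le> T b w" if "b \<in> B" "lo b \<le> w" for b w
  proof -
    have "?c b \<le> R b w" using that by (auto simp: R_def cutoff_def)
    then have "\<gamma> * ?c b \<le> \<gamma> * R b w" using assms by simp
    then have "T b (?c b) \<le> T b w"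
      using that c[OF that(1)] R_c[of b] by (simp add: T_eq)
    moreover have "0 \<le> T b (?c b)"
      unfolding T_c[OF that(1)] using Q_nonneg[OF that(1)] c(1)[OF that(1)] by simp
    ultimately show ?thesis by simp
  qed
  have meas: "(\<lambda>v. \<Sum>b\<in>B. bundle_price lo hi \<gamma> b (\<Sum>j\<in>b. v $ j))
      \<in> borel_measurable (restrict_space borel V)"
    unfolding bundle_price_def by (intro measurable_restrict_space1) measurable
  show ?thesis
    unfolding mechanisms_def mem_Collect_eq bundle_mechanism_def
  proof (intro conjI)
    have "0 \<le> (\<Sum>b\<in>B. bundle_price lo hi \<gamma> b (\<Sum>j\<in>b. v $ j))" if "v \<in> V" for v
      using T_nonneg W[OF that] by (intro sum_nonneg) (simp add: T_def W_def)
    moreover have "bundle_alloc B hi \<gamma> v $ j \<in> {0..1}" if "v \<in> V" for v j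
      using alloc[OF that] Q_nonneg Q_le W[OF that] bundle_of_in(1) by simp
    ultimately show "is_mechanism V (bundle_alloc B hi \<gamma>,
        \<lambda>v. \<Sum>b\<in>B. bundle_price lo hi \<gamma> b (\<Sum>j\<in>b. v $ j))"
      using meas by (simp add: is_mechanism_def)
    have "(\<Sum>b\<in>B. Q b (W v' b) * W v b - T b (W v' b)) \<le> (\<Sum>b\<in>B. Q b (W v b) * W v b - T b (W v b))"
      if "v \<in> V" "v' \<in> V" for v v'
      using that W by (intro sum_mono IC) auto
    then show "incentive_compatible V (bundle_alloc B hi \<gamma>,
        \<lambda>v. \<Sum>b\<in>B. bundle_price lo hi \<gamma> b (\<Sum>j\<in>b. v $ j))"
      by (simp add: incentive_compatible_def dot sum_subtractf T_def W_def)
    have "(\<Sum>b\<in>B. T b (W v b)) \<le> (\<Sum>b\<in>B. Q b (W v b) * W v b)" if "v \<in> V" for v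
      using that W by (intro sum_mono IR) auto
    then show "individually_rational V (bundle_alloc B hi \<gamma>,
        \<lambda>v. \<Sum>b\<in>B. bundle_price lo hi \<gamma> b (\<Sum>j\<in>b. v $ j))"
      by (simp add: individually_rational_def dot T_def W_def)
  qed
qed

lemma bundle_mechanism_ratio:
  assumes "0 < \<gamma>" "ratio_eqn B lo hi \<gamma> = 0"
  shows "approx_ratio V (bundle_mechanism B lo hi \<gamma>) = \<gamma>"
proof (rule antisym)
  let ?c = "cutoff lo hi \<gamma>"
  note mem = bundle_mechanism_in_mechanisms[OF assms(1)]
  show "approx_ratio V (bundle_mechanism B lo hi \<gamma>) \<le> \<gamma>"
    by (rule approx_ratio_le[OF mem assms])
  show "\<gamma> \<le> approx_ratio V (bundle_mechanism B lo hi \<gamma>)"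
  proof (rule approx_ratio_ge[OF mem less_imp_le[OF assms(1)]])
    fix v assume v: "v \<in> V"
    have "\<gamma> * (\<Sum>j\<in>UNIV. v $ j)
        = (\<Sum>b\<in>B. \<gamma> * (\<Sum>j\<in>b. v $ j) + ?c b - \<gamma> * (?c b * (1 + ln (hi b / ?c b))))"
      using assms(2) unfolding ratio_eqn_eq[OF assms(1)]
      by (simp add: sum_bundles sum_subtractf sum.distrib sum_distrib_left)
    also have "\<dots> \<le> (\<Sum>b\<in>B. bundle_price lo hi \<gamma> b (\<Sum>j\<in>b. v $ j))"
      using bundle_sum_range(1)[OF v] assms(1)
      by (intro sum_mono) (simp add: bundle_price_eq[OF _ assms(1)])
    finally show "\<gamma> * (\<Sum>j\<in>UNIV. v $ j) \<le> snd (bundle_mechanism B lo hi \<gamma>) v"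
      by (simp add: bundle_mechanism_def)
  qed
qed

text \<open>Intermediate value theorem on \<open>{\<epsilon>..1}\<close>, an interval away from the
  singularity of \<open>1 / \<gamma>\<close> at zero.\<close>

lemma ratio_eqn_root_exists: "\<exists>\<gamma>\<in>{0<..1}. ratio_eqn B lo hi \<gamma> = 0"
proof -
  define f where "f \<gamma> = (\<Sum>b\<in>B.
    \<gamma> * (cutoff lo hi \<gamma> b * (1 + ln (hi b / cutoff lo hi \<gamma> b))) - cutoff lo hi \<gamma> b)" for \<gamma>
  \<comment> \<open>Chosen so that the bound
    \<open>\<epsilon> * (\<Sum>b\<in>B. hi b) - (\<Sum>b\<in>B. lo b)\<close> on
    \<open>f \<epsilon>\<close> is zero.\<close>
  define \<epsilon> where "\<epsilon> = (\<Sum>b\<in>B. lo b) / (\<Sum>b\<in>B. hi b)"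
  have le: "(\<Sum>b\<in>B. lo b) \<le> (\<Sum>b\<in>B. hi b)" using bounds by (intro sum_mono) auto
  then have \<epsilon>: "0 < \<epsilon>" "\<epsilon> \<le> 1" "\<epsilon> * (\<Sum>b\<in>B. hi b) = (\<Sum>b\<in>B. lo b)"
    using sum_lo_pos by (auto simp: \<epsilon>_def)
  have "f \<epsilon> \<le> (\<Sum>b\<in>B. \<epsilon> * hi b - lo b)"
    unfolding f_def
  proof (intro sum_mono diff_mono mult_left_mono)
    fix b assume b: "b \<in> B"
    let ?c = "cutoff lo hi \<epsilon> b"
    note c = cutoff_bounds[OF b \<epsilon>(1)]
    have "?c * ln (hi b / ?c) \<le> ?c * (hi b / ?c - 1)"
      using c bounds[OF b] by (intro mult_left_mono ln_le_minus_one) auto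
    also have "\<dots> = hi b - ?c" using c by (simp add: field_simps)
    finally show "?c * (1 + ln (hi b / ?c)) \<le> hi b" by (simp add: distrib_left)
    show "lo b \<le> ?c" by (rule c(2))
  qed (use \<epsilon> in simp)
  then have "f \<epsilon> \<le> 0" using \<epsilon>(3) by (simp add: sum_subtractf sum_distrib_left[symmetric])
  moreover have "0 \<le> f 1"
    unfolding f_def
  proof (rule sum_nonneg)
    fix b assume b: "b \<in> B"
    show "0 \<le> 1 * (cutoff lo hi 1 b * (1 + ln (hi b / cutoff lo hi 1 b))) - cutoff lo hi 1 b"
      using cutoff_bounds[OF b, of 1] by (simp add: algebra_simps)
  qed
  moreover have "continuous_on {\<epsilon>..1} f"
  proof -
    have "continuous_on {\<epsilon>..1} (\<lambda>\<gamma>. cutoff lo hi \<gamma> b)" for b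
      unfolding cutoff_def using \<epsilon>(1) by (intro continuous_intros) auto
    then show ?thesis
      unfolding f_def using \<epsilon>(1) cutoff_bounds(1) bounds
      by (intro continuous_intros) (force simp: less_imp_neq[symmetric])+
  qed
  ultimately obtain \<gamma> where "\<epsilon> \<le> \<gamma>" "\<gamma> \<le> 1" "f \<gamma> = 0"
    using IVT'[of f \<epsilon> 0 1] \<epsilon>(2) by auto
  then show ?thesis using \<epsilon>(1) ratio_eqn_eq[of \<gamma>] by (force simp: f_def)
qed

end

theorem corollary4:
  fixes B :: "'n::finite set set" and lo hi :: "'n set \<Rightarrow> real"
  assumes "partition_on UNIV B"
    and "\<forall>b\<in>B. 0 \<le> lo b \<and> lo b \<le> hi b \<and> 0 < hi b"
    and "Max (lo ` B) > 0"
  defines "V \<equiv> bundle_valuations B lo hi"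
    and "g \<equiv> gamma_star B lo hi"
  shows "(\<exists>!\<gamma>. \<gamma> \<in> {0<..1} \<and> ratio_eqn B lo hi \<gamma> = 0)
    \<and> is_arg_max (approx_ratio V) (\<lambda>M. M \<in> mechanisms V) (bundle_mechanism B lo hi g)
    \<and> approx_ratio V (bundle_mechanism B lo hi g) = g"
proof -
  interpret bundle_bounds B lo hi
    using assms(1-3) by unfold_locales auto
  \<comment> \<open>Uniqueness comes for free: the value of the max-min problem equals every root.\<close>
  have "\<gamma> \<le> \<gamma>'" if "0 < \<gamma>" "ratio_eqn B lo hi \<gamma> = 0" "0 < \<gamma>'" "ratio_eqn B lo hi \<gamma>' = 0" for \<gamma> \<gamma>'
    using approx_ratio_le[OF bundle_mechanism_in_mechanisms[OF that(1)] that(3,4)]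
      bundle_mechanism_ratio[OF that(1,2)] by simp
  then have ex1: "\<exists>!\<gamma>. \<gamma> \<in> {0<..1} \<and> ratio_eqn B lo hi \<gamma> = 0"
    using ratio_eqn_root_exists by (force intro: antisym)
  from theI'[OF ex1] have g: "0 < g" "ratio_eqn B lo hi g = 0"
    by (auto simp: g_def gamma_star_def)
  note ratio = bundle_mechanism_ratio[OF g]
  have "is_arg_max (approx_ratio V) (\<lambda>M. M \<in> mechanisms V) (bundle_mechanism B lo hi g)"
    using bundle_mechanism_in_mechanisms[OF g(1)] approx_ratio_le[OF _ g] ratio
    by (auto simp: is_arg_max_def V_def not_less)
  with ex1 ratio show ?thesis by (simp add: V_def)
qed

end
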